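(* Let $\hat{\mathbf y}'=(\hat y_1',\hat y_2',\hat y_3')^T$, with each $\hat y_i'(t)\in \mathrm{span}\{\Phi_{\mathbf i}:\mathbf i\in F\}$, be a solution, for $t$ in a time interval contained in $[0,\infty)$, of the $t$-model system $$\begin{aligned} \frac{d\hat y_1'}{dt} &= \mathbf P\mathbf B(\hat y_1',\hat y_3')+t\,\mathbf P\mathbf B(\Gamma_1,\hat y_3')+t\,\mathbf P\mathbf B(\hat y_1',\Gamma_3),\\ \frac{d\hat y_2'}{dt} &= -\mathbf P\mathbf B(\hat y_2',\hat y_3')-t\,\mathbf P\mathbf B(\Gamma_2,\hat y_3')-t\,\mathbf P\mathbf B(\hat y_2',\Gamma_3),\\ \frac{d\hat y_3'}{dt} &= -\mathbf P\mathbf B(\hat y_1',\hat y_1')+\mathbf P\mathbf B(\hat y_2',\hat y_2')-t\,\mathbf P\{\mathbf B(\Gamma_1,\hat y_1')+\mathbf B(\hat y_1',\Gamma_1)\}+t\,\mathbf P\{\mathbf B(\Gamma_2,\hat y_2')+\mathbf B(\hat y_2',\Gamma_2)\}, \end{aligned}$$ where $$\Gamma_1=(\mathbf I-\mathbf P)\mathbf B(\hat y_1',\hat y_3'),\qquad \Gamma_2=-(\mathbf I-\mathbf P)\mathbf B(\hat y_2',\hat y_3'),\qquad \Gamma_3=-(\mathbf I-\mathbf P)\mathbf B(\hat y_1',\hat y_1')+(\mathbf I-\mathbf P)\mathbf B(\hat y_2',\hat y_2'),$$ and let $\mathbf\Gamma=(\Gamma_1,\Gamma_2,\Gamma_3)^T$.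 Then, for all $t$ in that interval, $$\frac12\frac{d}{dt}\|\hat{\mathbf y}'\|_{L_2(\Omega)}^2=-t\,\|\mathbf\Gamma\|_{L_2(\Omega)}^2 .$$
   Context: Let $(\Omega,\mathcal A,\mathcal P)$ be a probability space and $\boldsymbol\xi=(\xi_1,\dots,\xi_d)$ a $d$-dimensional random vector on it. For multi-indices $\mathbf i=(i_1,\dots,i_d)\in\mathbb N_0^d$ with $|\mathbf i|=i_1+\cdots+i_d$, let $\{\Phi_{\mathbf i}\}$ be a generalized polynomial chaos basis: $\Phi_{\mathbf i}=\Phi_{\mathbf i}(\boldsymbol\xi)$ is a real polynomial of degree $|\mathbf i|$ in $\boldsymbol\xi$, the family is orthonormal, $\int_\Omega\Phi_{\mathbf i}\Phi_{\mathbf j}\,d\mathcal P=\delta_{\mathbf i\mathbf j}$, and it spans the space of second-order (square-integrable) functions of $\boldsymbol\xi$. Here $L_2(\Omega)$ denotes this real Hilbert space of square-integrable functions of $\boldsymbol\xi$ with inner product $(f,g)=\int_\Omega fg\,d\mathcal P$; for a vector $\mathbf f=(f_1,f_2,f_3)^T$, $\|\mathbf f\|_{L_2(\Omega)}^2=\sum_{i=1}^3\|f_i\|_{L_2(\Omega)}^2$. Fix $p_r\in\mathbb N_0$ and let $F=\{\mathbf i:0\le|\mathbf i|\le p_r\}$ be the (finite) set of resolved indices. $\mathbf P$ is the orthogonal projection of $L_2(\Omega)$ onto $\mathrm{span}\{\Phi_{\mathbf i}:\mathbf i\in F\}$, $\mathbf I$ is the identity, and $\mathbf B(f,g)=fg$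 is the pointwise product. The $t$-model is a reduced model, for the resolved modes, of the (transformed) Kraichnan-Orszag three-mode system $\dot y_1=y_1y_3$, $\dot y_2=-y_2y_3$, $\dot y_3=-y_1^2+y_2^2$ with random initial data. *)

theory Defs
  imports "HOL-Probability.Probability"
begin

section \<open>The space of square-integrable functions of a random vector\<close>

text \<open>
  Elements of the space are represented by functions on the sample space, not by classes
  modulo almost-everywhere equality.
\<close>

definition L2_space :: "'a measure \<Rightarrow> ('a \<Rightarrow> real ^ 'd) \<Rightarrow> ('a \<Rightarrow> real) set" where
  "L2_space M \<xi> = {f. (\<exists>g \<in> borel_measurable borel. f = (\<lambda>\<omega>. g (\<xi> \<omega>))) \<and>
                      integrable M (\<lambda>\<omega>. (f \<omega>)\<^sup>2)}"

definition L2_inner :: "'a measure \<Rightarrow> ('a \<Rightarrow> real) \<Rightarrow> ('a \<Rightarrow> real) \<Rightarrow> real" where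
  "L2_inner M f g = (\<integral>\<omega>. f \<omega> * g \<omega> \<partial>M)"

definition L2_norm :: "'a measure \<Rightarrow> ('a \<Rightarrow> real) \<Rightarrow> real" where
  "L2_norm M f = sqrt (L2_inner M f f)"

definition L2_norm3 ::
  "'a measure \<Rightarrow> ('a \<Rightarrow> real) \<Rightarrow> ('a \<Rightarrow> real) \<Rightarrow> ('a \<Rightarrow> real) \<Rightarrow> real" where
  "L2_norm3 M f1 f2 f3 = sqrt ((L2_norm M f1)\<^sup>2 + (L2_norm M f2)\<^sup>2 + (L2_norm M f3)\<^sup>2)"

text \<open>
  Derivative of a curve in the space, with respect to the norm; it is one-sided at an end point
  of \<open>T\<close> that belongs to \<open>T\<close>.
\<close>

definition has_L2_derivative_within ::
  "'a measure \<Rightarrow> ('a \<Rightarrow> real ^ 'd) \<Rightarrow> real set \<Rightarrow> (real \<Rightarrow> 'a \<Rightarrow> real) \<Rightarrow> ('a \<Rightarrow> real) \<Rightarrow> real \<Rightarrow> bool"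
where
  "has_L2_derivative_within M \<xi> T y D t \<longleftrightarrow>
     (\<forall>s\<in>T. y s \<in> L2_space M \<xi>) \<and> D \<in> L2_space M \<xi> \<and>
     ((\<lambda>s. L2_norm M (\<lambda>\<omega>. (y s \<omega> - y t \<omega>) / (s - t) - D \<omega>)) \<longlongrightarrow> 0) (at t within T)"


section \<open>Generalized polynomial chaos\<close>

definition mi_abs :: "nat ^ 'd \<Rightarrow> nat" where
  "mi_abs i = (\<Sum>k\<in>UNIV. i $ k)"

lemma finite_mi_abs_le: "finite {i :: nat ^ 'd. mi_abs i \<le> n}"
proof -
  have "{i :: nat ^ 'd. mi_abs i \<le> n} \<subseteq> vec_lambda ` (UNIV \<rightarrow>\<^sub>E {..n})"
  proof
    fix i :: "nat ^ 'd"
    assume i: "i \<in> {i. mi_abs i \<le> n}"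
    have "i $ k \<le> n" for k
      using i member_le_sum[of k UNIV "\<lambda>k. i $ k"] by (simp add: mi_abs_def)
    then have "vec_nth i \<in> UNIV \<rightarrow>\<^sub>E {..n}" by (auto simp: PiE_def extensional_def)
    then show "i \<in> vec_lambda ` (UNIV \<rightarrow>\<^sub>E {..n})" by (metis image_eqI vec_nth_inverse)
  qed
  then show ?thesis
    by (rule finite_subset) (intro finite_imageI finite_PiE, auto)
qed

text \<open>Real polynomial functions in \<open>d\<close> variables of total degree exactly \<open>n\<close>.\<close>

definition poly_fun_of_degree :: "nat \<Rightarrow> (real ^ 'd \<Rightarrow> real) \<Rightarrow> bool" where
  "poly_fun_of_degree n p \<longleftrightarrow>
     (\<exists>a :: nat ^ 'd \<Rightarrow> real.
        (\<forall>x. p x = (\<Sum>m | mi_abs m \<le> n. a m * (\<Prod>k\<in>UNIV. (x $ k) ^ (m $ k)))) \<and>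
        (\<exists>m. mi_abs m = n \<and> a m \<noteq> 0))"

text \<open>The linear span of the random variables \<open>\<Phi> i (\<xi>)\<close> with \<open>i \<in> S\<close>; \<open>S\<close> may be infinite.\<close>

definition chaos_span ::
  "('a \<Rightarrow> real ^ 'd) \<Rightarrow> (nat ^ 'd \<Rightarrow> real ^ 'd \<Rightarrow> real) \<Rightarrow> (nat ^ 'd) set \<Rightarrow> ('a \<Rightarrow> real) set" where
  "chaos_span \<xi> \<Phi> S =
     {f. \<exists>A c. finite A \<and> A \<subseteq> S \<and> f = (\<lambda>\<omega>. \<Sum>i\<in>A. c i * \<Phi> i (\<xi> \<omega>))}"

text \<open>The last conjunct says that the linear span of the family is dense, i.e. that the family is
  a complete orthonormal system (Hilbert-space basis).\<close>

definition gpc_basis ::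
  "'a measure \<Rightarrow> ('a \<Rightarrow> real ^ 'd) \<Rightarrow> (nat ^ 'd \<Rightarrow> real ^ 'd \<Rightarrow> real) \<Rightarrow> bool" where
  "gpc_basis M \<xi> \<Phi> \<longleftrightarrow>
     (\<forall>i. poly_fun_of_degree (mi_abs i) (\<Phi> i)) \<and>
     (\<forall>i. (\<lambda>\<omega>. \<Phi> i (\<xi> \<omega>)) \<in> L2_space M \<xi>) \<and>
     (\<forall>i j. L2_inner M (\<lambda>\<omega>. \<Phi> i (\<xi> \<omega>)) (\<lambda>\<omega>. \<Phi> j (\<xi> \<omega>)) = (if i = j then 1 else 0)) \<and>
     (\<forall>f \<in> L2_space M \<xi>. \<forall>\<epsilon>>0. \<exists>g \<in> chaos_span \<xi> \<Phi> UNIV. L2_norm M (\<lambda>\<omega>. f \<omega> - g \<omega>) < \<epsilon>)"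

definition resolved :: "nat \<Rightarrow> (nat ^ 'd) set" where
  "resolved p = {i. mi_abs i \<le> p}"

text \<open>
  Orthogonal projection onto a subspace \<open>V\<close>.  For \<open>V = chaos_span \<xi> \<Phi> S\<close> with \<open>S\<close> finite and
  \<open>\<Phi>\<close> orthonormal, the projection is unique as a function and not just almost everywhere,
  because an element of \<open>V\<close> that vanishes almost everywhere has all its coefficients equal to \<open>0\<close>.
\<close>

definition orth_proj :: "'a measure \<Rightarrow> ('a \<Rightarrow> real) set \<Rightarrow> ('a \<Rightarrow> real) \<Rightarrow> ('a \<Rightarrow> real)" where
  "orth_proj M V f = (THE g. g \<in> V \<and> (\<forall>h\<in>V. L2_inner M (\<lambda>\<omega>. f \<omega> - g \<omega>) h = 0))"


section \<open>The t-model\<close>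

definition B :: "('a \<Rightarrow> real) \<Rightarrow> ('a \<Rightarrow> real) \<Rightarrow> ('a \<Rightarrow> real)" where
  "B f g = (\<lambda>\<omega>. f \<omega> * g \<omega>)"

text \<open>In the following definitions \<open>P\<close> is the projection onto the resolved modes.\<close>

definition compl_proj :: "(('a \<Rightarrow> real) \<Rightarrow> ('a \<Rightarrow> real)) \<Rightarrow> ('a \<Rightarrow> real) \<Rightarrow> ('a \<Rightarrow> real)" where
  "compl_proj P f = (\<lambda>\<omega>. f \<omega> - P f \<omega>)"

definition Gamma1 ::
  "(('a \<Rightarrow> real) \<Rightarrow> ('a \<Rightarrow> real)) \<Rightarrow> ('a \<Rightarrow> real) \<Rightarrow> ('a \<Rightarrow> real) \<Rightarrow> ('a \<Rightarrow> real)" where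
  "Gamma1 P u1 u3 = compl_proj P (B u1 u3)"

definition Gamma2 ::
  "(('a \<Rightarrow> real) \<Rightarrow> ('a \<Rightarrow> real)) \<Rightarrow> ('a \<Rightarrow> real) \<Rightarrow> ('a \<Rightarrow> real) \<Rightarrow> ('a \<Rightarrow> real)" where
  "Gamma2 P u2 u3 = (\<lambda>\<omega>. - compl_proj P (B u2 u3) \<omega>)"

definition Gamma3 ::
  "(('a \<Rightarrow> real) \<Rightarrow> ('a \<Rightarrow> real)) \<Rightarrow> ('a \<Rightarrow> real) \<Rightarrow> ('a \<Rightarrow> real) \<Rightarrow> ('a \<Rightarrow> real)" where
  "Gamma3 P u1 u2 = (\<lambda>\<omega>. - compl_proj P (B u1 u1) \<omega> + compl_proj P (B u2 u2) \<omega>)"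

definition t_model_rhs1 ::
  "(('a \<Rightarrow> real) \<Rightarrow> ('a \<Rightarrow> real)) \<Rightarrow> real \<Rightarrow> ('a \<Rightarrow> real) \<Rightarrow> ('a \<Rightarrow> real) \<Rightarrow> ('a \<Rightarrow> real) \<Rightarrow> ('a \<Rightarrow> real)"
where
  "t_model_rhs1 P t u1 u2 u3 =
     (\<lambda>\<omega>. P (B u1 u3) \<omega> + t * P (B (Gamma1 P u1 u3) u3) \<omega> + t * P (B u1 (Gamma3 P u1 u2)) \<omega>)"

definition t_model_rhs2 ::
  "(('a \<Rightarrow> real) \<Rightarrow> ('a \<Rightarrow> real)) \<Rightarrow> real \<Rightarrow> ('a \<Rightarrow> real) \<Rightarrow> ('a \<Rightarrow> real) \<Rightarrow> ('a \<Rightarrow> real) \<Rightarrow> ('a \<Rightarrow> real)"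
where
  "t_model_rhs2 P t u1 u2 u3 =
     (\<lambda>\<omega>. - P (B u2 u3) \<omega> - t * P (B (Gamma2 P u2 u3) u3) \<omega> - t * P (B u2 (Gamma3 P u1 u2)) \<omega>)"

definition t_model_rhs3 ::
  "(('a \<Rightarrow> real) \<Rightarrow> ('a \<Rightarrow> real)) \<Rightarrow> real \<Rightarrow> ('a \<Rightarrow> real) \<Rightarrow> ('a \<Rightarrow> real) \<Rightarrow> ('a \<Rightarrow> real) \<Rightarrow> ('a \<Rightarrow> real)"
where
  "t_model_rhs3 P t u1 u2 u3 =
     (\<lambda>\<omega>. - P (B u1 u1) \<omega> + P (B u2 u2) \<omega>
          - t * P (\<lambda>\<omega>'. B (Gamma1 P u1 u3) u1 \<omega>' + B u1 (Gamma1 P u1 u3) \<omega>') \<omega>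
          + t * P (\<lambda>\<omega>'. B (Gamma2 P u2 u3) u2 \<omega>' + B u2 (Gamma2 P u2 u3) \<omega>') \<omega>)"

definition t_model_solution ::
  "'a measure \<Rightarrow> ('a \<Rightarrow> real ^ 'd) \<Rightarrow> (nat ^ 'd \<Rightarrow> real ^ 'd \<Rightarrow> real) \<Rightarrow> nat \<Rightarrow> real set \<Rightarrow>
   (real \<Rightarrow> 'a \<Rightarrow> real) \<Rightarrow> (real \<Rightarrow> 'a \<Rightarrow> real) \<Rightarrow> (real \<Rightarrow> 'a \<Rightarrow> real) \<Rightarrow> bool" where
  "t_model_solution M \<xi> \<Phi> p T y1 y2 y3 \<longleftrightarrow>
     (let V = chaos_span \<xi> \<Phi> (resolved p); P = orth_proj M V in
      \<forall>t\<in>T. y1 t \<in> V \<and> y2 t \<in> V \<and> y3 t \<in> V \<and>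
        has_L2_derivative_within M \<xi> T y1 (t_model_rhs1 P t (y1 t) (y2 t) (y3 t)) t \<and>
        has_L2_derivative_within M \<xi> T y2 (t_model_rhs2 P t (y1 t) (y2 t) (y3 t)) t \<and>
        has_L2_derivative_within M \<xi> T y3 (t_model_rhs3 P t (y1 t) (y2 t) (y3 t)) t)"

end

theory Submission
  imports Defs "HOL-Library.Function_Algebras"
begin

(* Since P is self-adjoint and fixes the components u1, u2, u3 of the solution, it disappears
   from the inner products of the equations with these components. The terms without the factor t
   cancel, as u1 (u1 u3) - u2 (u2 u3) + u3 (u2^2 - u1^2) = 0. The terms with the factor t add up to
     - t (Gamma1, u1 u3) + t (Gamma2, u2 u3) + t (Gamma3, u1^2 - u2^2),
   and each Gamma_i is, up to sign, the unresolved part of the function it is paired with here, so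
   that this is minus t times the squared norm of Gamma.

   All products have to be square integrable. By a count of dimensions, the basis elements of degree
   at most n, which are linearly independent because they are orthonormal, span all polynomials of
   degree at most n. Hence every polynomial in the random vector is square integrable. *)

section \<open>Real-valued functions as vectors: span and independence\<close>

interpretation fun_space: vector_space "\<lambda>(c::real) (f::'a \<Rightarrow> real) x. c * f x"
  by unfold_locales (auto simp: algebra_simps fun_eq_iff)

lemma sum_fun_apply: "(\<Sum>i\<in>A. f i) x = (\<Sum>i\<in>A. f i x)"
  for f :: "'b \<Rightarrow> 'a \<Rightarrow> 'c::comm_monoid_add"
  by (induction A rule: infinite_finite_induct) auto

text \<open>If some \<open>x\<close> in \<open>T\<close> were outside the span of \<open>S\<close>,
  then \<open>insert x S\<close> would be an independent subset of the span of \<open>T\<close> with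
  more than \<open>card T\<close> elements. Later \<open>T\<close> consists of monomials and
  \<open>S\<close> of basis elements, up to the same degree.\<close>

lemma (in vector_space) subset_span_if_card_le_independent:
  assumes "independent S" "S \<subseteq> span T" "finite T" "card T \<le> card S"
  shows "T \<subseteq> span S"
proof
  fix x assume "x \<in> T"
  show "x \<in> span S"
  proof (rule ccontr)
    assume x: "x \<notin> span S"
    have "independent (insert x S)" using assms(1) x by (simp add: independent_insertI)
    moreover have "insert x S \<subseteq> span T" using \<open>x \<in> T\<close> assms(2) by (auto intro: span_base)
    ultimately have "finite (insert x S) \<and> card (insert x S) \<le> card T"
      by (rule independent_span_bound[OF assms(3)])
    moreover have "x \<notin> S" using x span_base by blast
    ultimately show False using assms(4) by auto
  qed
qed


section \<open>Square-integrable functions of a random vector\<close>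

lemma L2_norm_power2: "(L2_norm M f)\<^sup>2 = L2_inner M f f"
  unfolding L2_norm_def L2_inner_def by simp

lemma L2_inner_self_nonneg: "0 \<le> L2_inner M f f"
  unfolding L2_inner_def by simp

lemma L2_norm3_power2:
  "(L2_norm3 M f g h)\<^sup>2 = L2_inner M f f + L2_inner M g g + L2_inner M h h"
  unfolding L2_norm3_def by (simp add: L2_norm_power2 L2_inner_self_nonneg)

lemma L2_inner_commute: "L2_inner M f g = L2_inner M g f"
  by (simp add: L2_inner_def mult.commute)

text \<open>Scalars come out with no integrability assumption, since a non-integrable function has
  integral 0 and a nonzero factor keeps it non-integrable. Additivity fails in that generality and
  is proved below within \<open>L2_space\<close>.\<close>

lemma L2_inner_mult_left: "L2_inner M (\<lambda>\<omega>. c * f \<omega>) g = c * L2_inner M f g"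
  by (simp add: L2_inner_def mult.assoc)

lemma L2_inner_mult_right: "L2_inner M f (\<lambda>\<omega>. c * g \<omega>) = c * L2_inner M f g"
  by (simp add: L2_inner_def mult.left_commute)

lemma L2_inner_minus_left: "L2_inner M (\<lambda>\<omega>. - f \<omega>) g = - L2_inner M f g"
  by (simp add: L2_inner_def)

lemma L2_inner_minus_right: "L2_inner M f (\<lambda>\<omega>. - g \<omega>) = - L2_inner M f g"
  by (simp add: L2_inner_def)

locale random_vector =
  fixes M :: "'a measure" and \<xi> :: "'a \<Rightarrow> real ^ 'd"
  assumes measurable_\<xi>: "\<xi> \<in> borel_measurable M"
begin

section \<open>Closure properties of the space and bilinearity of the inner product\<close>

lemma L2_space_measurable:
  assumes "f \<in> L2_space M \<xi>" shows "f \<in> borel_measurable M"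
  using assms measurable_\<xi> unfolding L2_space_def by auto

lemma integrable_mult_L2:
  assumes "f \<in> L2_space M \<xi>" "g \<in> L2_space M \<xi>"
  shows "integrable M (\<lambda>\<omega>. f \<omega> * g \<omega>)"
proof (rule Bochner_Integration.integrable_bound)
  show "integrable M (\<lambda>\<omega>. (f \<omega>)\<^sup>2 + (g \<omega>)\<^sup>2)"
    using assms by (auto simp: L2_space_def)
  show "(\<lambda>\<omega>. f \<omega> * g \<omega>) \<in> borel_measurable M"
    using assms[THEN L2_space_measurable] by measurable
  have "\<bar>a * b\<bar> \<le> a\<^sup>2 + b\<^sup>2" for a b :: real
  proof -
    have "0 \<le> (\<bar>a\<bar> - \<bar>b\<bar>)\<^sup>2" by simp
    then have "2 * (\<bar>a\<bar> * \<bar>b\<bar>) \<le> a\<^sup>2 + b\<^sup>2" by (simp add: power2_diff)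
    moreover have "0 \<le> \<bar>a\<bar> * \<bar>b\<bar>" by simp
    ultimately show ?thesis unfolding abs_mult by linarith
  qed
  then show "AE \<omega> in M. norm (f \<omega> * g \<omega>) \<le> norm ((f \<omega>)\<^sup>2 + (g \<omega>)\<^sup>2)" by simp
qed

lemma L2_space_mult:
  assumes "f \<in> L2_space M \<xi>" shows "(\<lambda>\<omega>. c * f \<omega>) \<in> L2_space M \<xi>"
proof -
  from assms obtain g where g: "g \<in> borel_measurable borel" "f = (\<lambda>\<omega>. g (\<xi> \<omega>))"
    and i: "integrable M (\<lambda>\<omega>. (f \<omega>)\<^sup>2)"
    by (auto simp: L2_space_def)
  have "(\<lambda>x. c * g x) \<in> borel_measurable borel" using g(1) by simp
  moreover have "integrable M (\<lambda>\<omega>. (c * f \<omega>)\<^sup>2)" using i by (simp add: power_mult_distrib)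
  ultimately show ?thesis
    unfolding L2_space_def g(2) by (intro CollectI conjI bexI[of _ "\<lambda>x. c * g x"]) auto
qed

lemma L2_space_add:
  assumes "f \<in> L2_space M \<xi>" "g \<in> L2_space M \<xi>"
  shows "(\<lambda>\<omega>. f \<omega> + g \<omega>) \<in> L2_space M \<xi>"
proof -
  from assms obtain f' g' where
    m: "f' \<in> borel_measurable borel" "f = (\<lambda>\<omega>. f' (\<xi> \<omega>))"
       "g' \<in> borel_measurable borel" "g = (\<lambda>\<omega>. g' (\<xi> \<omega>))"
    and i: "integrable M (\<lambda>\<omega>. (f \<omega>)\<^sup>2)" "integrable M (\<lambda>\<omega>. (g \<omega>)\<^sup>2)"
    by (auto simp: L2_space_def)
  have "(\<lambda>x. f' x + g' x) \<in> borel_measurable borel" using m by simp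
  moreover have "integrable M (\<lambda>\<omega>. (f \<omega> + g \<omega>)\<^sup>2)"
    using i integrable_mult_L2[OF assms] by (simp add: power2_sum mult.assoc)
  ultimately show ?thesis
    unfolding L2_space_def m(2,4) by (intro CollectI conjI bexI[of _ "\<lambda>x. f' x + g' x"]) auto
qed

lemma L2_space_diff:
  assumes "f \<in> L2_space M \<xi>" "g \<in> L2_space M \<xi>"
  shows "(\<lambda>\<omega>. f \<omega> - g \<omega>) \<in> L2_space M \<xi>"
  using L2_space_add[OF assms(1) L2_space_mult[OF assms(2), of "-1"]] by simp

lemma L2_space_zero: "(\<lambda>\<omega>. 0) \<in> L2_space M \<xi>"
  by (auto simp: L2_space_def intro!: bexI[of _ "\<lambda>_. 0"])

lemma subspace_L2_space: "fun_space.subspace (L2_space M \<xi>)"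
  unfolding fun_space.subspace_def zero_fun_def plus_fun_def
  by (simp add: L2_space_zero L2_space_add L2_space_mult)

lemma L2_inner_add_left:
  assumes "f \<in> L2_space M \<xi>" "g \<in> L2_space M \<xi>" "h \<in> L2_space M \<xi>"
  shows "L2_inner M (\<lambda>\<omega>. f \<omega> + g \<omega>) h = L2_inner M f h + L2_inner M g h"
  unfolding L2_inner_def using assms by (simp add: distrib_right integrable_mult_L2)

lemma L2_inner_diff_left:
  assumes "f \<in> L2_space M \<xi>" "g \<in> L2_space M \<xi>" "h \<in> L2_space M \<xi>"
  shows "L2_inner M (\<lambda>\<omega>. f \<omega> - g \<omega>) h = L2_inner M f h - L2_inner M g h"
  unfolding L2_inner_def using assms by (simp add: left_diff_distrib integrable_mult_L2)

lemma L2_inner_add_right: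
  assumes "f \<in> L2_space M \<xi>" "g \<in> L2_space M \<xi>" "h \<in> L2_space M \<xi>"
  shows "L2_inner M h (\<lambda>\<omega>. f \<omega> + g \<omega>) = L2_inner M h f + L2_inner M h g"
  using L2_inner_add_left[OF assms] by (simp add: L2_inner_commute[of M h])

lemma L2_inner_diff_right:
  assumes "f \<in> L2_space M \<xi>" "g \<in> L2_space M \<xi>" "h \<in> L2_space M \<xi>"
  shows "L2_inner M h (\<lambda>\<omega>. f \<omega> - g \<omega>) = L2_inner M h f - L2_inner M h g"
  using L2_inner_diff_left[OF assms] by (simp add: L2_inner_commute[of M h])

lemma L2_inner_sum_left:
  assumes "\<And>i. i \<in> A \<Longrightarrow> f i \<in> L2_space M \<xi>" "h \<in> L2_space M \<xi>"
  shows "L2_inner M (\<lambda>\<omega>. \<Sum>i\<in>A. c i * f i \<omega>) h = (\<Sum>i\<in>A. c i * L2_inner M (f i) h)"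
proof -
  have "L2_inner M (\<lambda>\<omega>. \<Sum>i\<in>A. c i * f i \<omega>) h
      = (\<integral>\<omega>. (\<Sum>i\<in>A. c i * (f i \<omega> * h \<omega>)) \<partial>M)"
    by (simp add: L2_inner_def sum_distrib_right mult.assoc)
  also have "\<dots> = (\<Sum>i\<in>A. \<integral>\<omega>. c i * (f i \<omega> * h \<omega>) \<partial>M)"
    using assms by (intro Bochner_Integration.integral_sum) (auto intro!: integrable_mult_L2)
  finally show ?thesis by (simp add: L2_inner_def)
qed

text \<open>The squared norm of \<open>f - c * g\<close> is a nonnegative quadratic in
  \<open>c\<close>, and one well-chosen \<open>c\<close> gives the bound.\<close>

lemma L2_Cauchy_Schwarz:
  assumes f: "f \<in> L2_space M \<xi>" and g: "g \<in> L2_space M \<xi>"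
  shows "\<bar>L2_inner M f g\<bar> \<le> L2_norm M f * L2_norm M g"
proof -
  let ?a = "L2_inner M g g" and ?b = "L2_inner M f g"
  have quad: "0 \<le> L2_inner M f f - 2 * c * ?b + c\<^sup>2 * ?a" for c
  proof -
    have cg: "(\<lambda>\<omega>. c * g \<omega>) \<in> L2_space M \<xi>" by (rule L2_space_mult[OF g])
    have "0 \<le> L2_inner M (\<lambda>\<omega>. f \<omega> - c * g \<omega>) (\<lambda>\<omega>. f \<omega> - c * g \<omega>)"
      by (rule L2_inner_self_nonneg)
    also have "\<dots> = L2_inner M f f - 2 * c * ?b + c\<^sup>2 * ?a"
      by (simp add: L2_inner_diff_left L2_inner_diff_right L2_space_diff f g cg L2_inner_mult_left
          L2_inner_mult_right L2_inner_commute[of M g f] power2_eq_square algebra_simps)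
    finally show ?thesis .
  qed
  have "?b\<^sup>2 \<le> L2_inner M f f * ?a"
  proof (cases "?a = 0")
    case True
    have "?b = 0"
    proof (rule ccontr)
      assume "?b \<noteq> 0"
      \<comment> \<open>With \<open>?a = 0\<close> the quadratic is affine in \<open>c\<close>, and
        this \<open>c\<close> gives it the value -1.\<close>
      then show False
        using quad[of "(L2_inner M f f + 1) / (2 * ?b)"] True by simp
    qed
    then show ?thesis using True by simp
  next
    case False
    then have pos: "0 < ?a" using L2_inner_self_nonneg[of M g] by simp
    \<comment> \<open>The minimum of the quadratic is at \<open>c = ?b / ?a\<close>.\<close>
    have "0 \<le> ?a * (L2_inner M f f - 2 * (?b / ?a) * ?b + (?b / ?a)\<^sup>2 * ?a)"
      using pos by (intro mult_nonneg_nonneg quad) simp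
    also have "\<dots> = L2_inner M f f * ?a - ?b\<^sup>2"
      using pos by (simp add: field_simps power2_eq_square)
    finally show ?thesis by simp
  qed
  then have "sqrt (?b\<^sup>2) \<le> sqrt (L2_inner M f f * ?a)" by (rule real_sqrt_le_mono)
  then show ?thesis by (simp add: L2_norm_def real_sqrt_mult)
qed

text \<open>Let \<open>r s\<close> be the error of the difference quotient, so that
  \<open>y s = y t + (s - t) * (D + r s)\<close>. Expand the squared norm: by Cauchy-Schwarz the
  inner products with \<open>r s\<close> tend to 0, and what is quadratic in \<open>D + r s\<close>
  keeps a factor \<open>s - t\<close>.\<close>

lemma has_L2_derivative_within_norm_square:
  assumes deriv: "has_L2_derivative_within M \<xi> T y D t" and "t \<in> T"
  shows "((\<lambda>s. L2_inner M (y s) (y s)) has_real_derivative 2 * L2_inner M (y t) D) (at t within T)"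
proof -
  have y: "\<And>s. s \<in> T \<Longrightarrow> y s \<in> L2_space M \<xi>" and D: "D \<in> L2_space M \<xi>"
    using deriv by (auto simp: has_L2_derivative_within_def)
  note yt = y[OF \<open>t \<in> T\<close>]
  define r where "r s = (\<lambda>\<omega>. (y s \<omega> - y t \<omega>) / (s - t) - D \<omega>)" for s
  \<comment> \<open>The case \<open>s = t\<close> is included: division by 0 gives 0, so
    \<open>r t\<close> is \<open>- D\<close>.\<close>
  have r: "r s \<in> L2_space M \<xi>" if "s \<in> T" for s
    using L2_space_diff[OF L2_space_mult[OF L2_space_diff[OF y[OF that] yt], of "1 / (s - t)"] D]
    by (simp add: r_def)
  have lim: "((\<lambda>s. L2_norm M (r s)) \<longlongrightarrow> 0) (at t within T)"
    using deriv by (simp add: has_L2_derivative_within_def r_def)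
  have inner_lim: "((\<lambda>s. L2_inner M h (r s)) \<longlongrightarrow> 0) (at t within T)"
    if h: "h \<in> L2_space M \<xi>" for h
  proof (rule Lim_null_comparison)
    show "\<forall>\<^sub>F s in at t within T. norm (L2_inner M h (r s)) \<le> L2_norm M h * L2_norm M (r s)"
      using L2_Cauchy_Schwarz[OF h r] by (auto simp: eventually_at_filter)
    show "((\<lambda>s. L2_norm M h * L2_norm M (r s)) \<longlongrightarrow> 0) (at t within T)"
      using tendsto_mult_right_zero[OF lim] .
  qed
  have self_lim: "((\<lambda>s. L2_inner M (r s) (r s)) \<longlongrightarrow> 0) (at t within T)"
    using tendsto_mult[OF lim lim] by (simp add: L2_norm_power2 flip: power2_eq_square)
  \<comment> \<open>For \<open>s\<close> in \<open>T\<close> other than \<open>t\<close> this is the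
    difference quotient of the squared norm, in a form that shows its limit.\<close>
  define e where "e s = 2 * (L2_inner M (y t) D + L2_inner M (y t) (r s)) +
    (s - t) * (L2_inner M D D + 2 * L2_inner M D (r s) + L2_inner M (r s) (r s))" for s
  have "(e \<longlongrightarrow> 2 * (L2_inner M (y t) D + 0) + (t - t) * (L2_inner M D D + 2 * 0 + 0))
      (at t within T)"
    unfolding e_def
    by (intro tendsto_add tendsto_mult tendsto_const tendsto_diff tendsto_ident_at
        inner_lim self_lim yt D)
  then have "(e \<longlongrightarrow> 2 * L2_inner M (y t) D) (at t within T)" by simp
  moreover have "e s = (L2_inner M (y s) (y s) - L2_inner M (y t) (y t)) / (s - t)"
    if "s \<in> T" "s \<noteq> t" for s
  proof -
    have ys: "y s = (\<lambda>\<omega>. y t \<omega> + (s - t) * (D \<omega> + r s \<omega>))"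
      using \<open>s \<noteq> t\<close> by (simp add: r_def fun_eq_iff)
    have Dr: "(\<lambda>\<omega>. D \<omega> + r s \<omega>) \<in> L2_space M \<xi>" by (intro L2_space_add D r that)
    have sDr: "(\<lambda>\<omega>. (s - t) * (D \<omega> + r s \<omega>)) \<in> L2_space M \<xi>" by (rule L2_space_mult[OF Dr])
    have "L2_inner M (y s) (y s) = L2_inner M (y t) (y t)
        + 2 * (s - t) * L2_inner M (y t) (\<lambda>\<omega>. D \<omega> + r s \<omega>)
        + (s - t)\<^sup>2 * L2_inner M (\<lambda>\<omega>. D \<omega> + r s \<omega>) (\<lambda>\<omega>. D \<omega> + r s \<omega>)"
      unfolding ys
      by (simp only: L2_inner_add_left L2_inner_add_right yt Dr sDr L2_space_add L2_inner_mult_left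
          L2_inner_mult_right L2_inner_commute[of M "\<lambda>\<omega>. D \<omega> + r s \<omega>" "y t"])
        (simp add: power2_eq_square algebra_simps)
    also have "\<dots> = L2_inner M (y t) (y t) + (s - t) * e s"
      by (simp add: e_def L2_inner_add_left L2_inner_add_right yt D r[OF \<open>s \<in> T\<close>] L2_space_add
          L2_inner_commute[of M "r s" D] power2_eq_square algebra_simps)
    finally show ?thesis using \<open>s \<noteq> t\<close> by (simp add: field_simps)
  qed
  then have "\<forall>\<^sub>F s in at t within T.
      e s = (L2_inner M (y s) (y s) - L2_inner M (y t) (y t)) / (s - t)"
    by (auto simp: eventually_at_filter)
  ultimately show ?thesis
    unfolding has_field_derivative_iff by (rule Lim_transform_eventually)
qed


section \<open>Polynomials in a random vector\<close>

text \<open>These are functions on the sample space, so a priori different exponents may give the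
  same one.\<close>

definition monomial :: "nat ^ 'd \<Rightarrow> 'a \<Rightarrow> real" where
  "monomial m = (\<lambda>\<omega>. \<Prod>k\<in>UNIV. (\<xi> \<omega> $ k) ^ (m $ k))"

definition polynomials :: "('a \<Rightarrow> real) set" where
  "polynomials = fun_space.span (range monomial)"

lemma subspace_polynomials: "fun_space.subspace polynomials"
  by (simp add: polynomials_def fun_space.subspace_span)

lemma polynomials_add:
  "f \<in> polynomials \<Longrightarrow> g \<in> polynomials \<Longrightarrow> (\<lambda>\<omega>. f \<omega> + g \<omega>) \<in> polynomials"
  using fun_space.subspace_add[OF subspace_polynomials] by (simp add: plus_fun_def)

lemma polynomials_mult: "f \<in> polynomials \<Longrightarrow> (\<lambda>\<omega>. c * f \<omega>) \<in> polynomials"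
  using fun_space.subspace_scale[OF subspace_polynomials] .

lemma polynomials_uminus: "f \<in> polynomials \<Longrightarrow> (\<lambda>\<omega>. - f \<omega>) \<in> polynomials"
  using polynomials_mult[of f "-1"] by simp

lemma polynomials_diff:
  "f \<in> polynomials \<Longrightarrow> g \<in> polynomials \<Longrightarrow> (\<lambda>\<omega>. f \<omega> - g \<omega>) \<in> polynomials"
  using polynomials_add[OF _ polynomials_uminus] by simp

lemma B_monomial: "B (monomial m) (monomial n) = monomial (m + n)"
  by (simp add: B_def monomial_def power_add prod.distrib)

text \<open>Monomials are closed under products and \<open>B\<close> is bilinear, so induction over
  the span works for one factor at a time: first with a monomial on the left, then for any left
  factor.\<close>

lemma polynomials_B:
  assumes "f \<in> polynomials" "g \<in> polynomials"
  shows "B f g \<in> polynomials"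
proof -
  have mono: "B (monomial m) h \<in> polynomials" if "h \<in> polynomials" for m h
    using that unfolding polynomials_def
  proof (induction rule: fun_space.span_induct_alt)
    case base
    have "B (monomial m) 0 = 0" by (simp add: B_def fun_eq_iff)
    then show ?case using fun_space.span_zero[of "range monomial"] by metis
  next
    case (step c x h)
    then obtain n where "x = monomial n" by auto
    then have eq: "B (monomial m) ((\<lambda>\<omega>. c * x \<omega>) + h)
        = (\<lambda>\<omega>. c * monomial (m + n) \<omega>) + B (monomial m) h"
      by (simp add: B_monomial[symmetric] fun_eq_iff) (simp add: B_def algebra_simps)
    show ?case
      unfolding eq
      by (intro fun_space.span_add fun_space.span_scale fun_space.span_base rangeI step.IH)
  qed
  have "f \<in> fun_space.span (range monomial)" using assms by (simp add: polynomials_def)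
  then show ?thesis
  proof (induction rule: fun_space.span_induct_alt)
    case base
    have "B 0 g = 0" by (simp add: B_def fun_eq_iff)
    then show ?case using fun_space.subspace_0[OF subspace_polynomials] by metis
  next
    case (step c x h)
    then obtain n where n: "x = monomial n" by auto
    have eq: "B ((\<lambda>\<omega>. c * x \<omega>) + h) g = (\<lambda>\<omega>. c * B (monomial n) g \<omega> + B h g \<omega>)"
      by (simp add: n fun_eq_iff B_def algebra_simps)
    show ?case
      unfolding eq by (intro polynomials_add polynomials_mult mono assms(2) step.IH)
  qed
qed

lemma poly_fun_of_degree_in_span:
  assumes "poly_fun_of_degree n p"
  shows "(\<lambda>\<omega>. p (\<xi> \<omega>)) \<in> fun_space.span (monomial ` {m. mi_abs m \<le> n})"
proof -
  obtain a where "\<And>x. p x = (\<Sum>m | mi_abs m \<le> n. a m * (\<Prod>k\<in>UNIV. (x $ k) ^ (m $ k)))"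
    using assms by (auto simp: poly_fun_of_degree_def)
  then have "(\<lambda>\<omega>. p (\<xi> \<omega>)) = (\<Sum>m | mi_abs m \<le> n. (\<lambda>\<omega>. a m * monomial m \<omega>))"
    by (simp add: fun_eq_iff sum_fun_apply monomial_def)
  also have "\<dots> \<in> fun_space.span (monomial ` {m. mi_abs m \<le> n})"
    by (intro fun_space.span_sum fun_space.span_scale fun_space.span_base imageI)
  finally show ?thesis .
qed

end


section \<open>Polynomial chaos\<close>

locale gpc = random_vector M \<xi> for M :: "'a measure" and \<xi> :: "'a \<Rightarrow> real ^ 'd" +
  fixes \<Phi> :: "nat ^ 'd \<Rightarrow> real ^ 'd \<Rightarrow> real"
  assumes basis: "gpc_basis M \<xi> \<Phi>"
begin

section \<open>The chaos basis as an orthonormal system\<close>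

definition X :: "nat ^ 'd \<Rightarrow> 'a \<Rightarrow> real" where
  "X i = (\<lambda>\<omega>. \<Phi> i (\<xi> \<omega>))"

lemma X_L2: "X i \<in> L2_space M \<xi>"
  using basis by (simp add: gpc_basis_def X_def)

lemma X_orthonormal: "L2_inner M (X i) (X j) = (if i = j then 1 else 0)"
  using basis by (simp add: gpc_basis_def X_def)

lemma inj_X: "inj X"
proof (rule injI)
  fix i j assume "X i = X j"
  then have "L2_inner M (X i) (X j) = 1" by (simp add: X_orthonormal)
  then show "i = j" by (simp add: X_orthonormal split: if_splits)
qed

lemma chaos_spanI:
  assumes "finite A" "A \<subseteq> S"
  shows "(\<lambda>\<omega>. \<Sum>i\<in>A. c i * X i \<omega>) \<in> chaos_span \<xi> \<Phi> S"
  unfolding chaos_span_def X_def mem_Collect_eq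
  by (rule exI[of _ A], rule exI[of _ c]) (simp add: assms)

lemma chaos_spanE:
  assumes "f \<in> chaos_span \<xi> \<Phi> S"
  obtains A c where "finite A" "A \<subseteq> S" "f = (\<lambda>\<omega>. \<Sum>i\<in>A. c i * X i \<omega>)"
proof -
  from assms have "\<exists>A c. finite A \<and> A \<subseteq> S \<and> f = (\<lambda>\<omega>. \<Sum>i\<in>A. c i * X i \<omega>)"
    unfolding chaos_span_def X_def mem_Collect_eq .
  then show ?thesis by (elim exE conjE) (rule that)
qed

text \<open>Padding the coefficients with 0 gives all elements the common index set
  \<open>S\<close>, so that coefficients can be compared.\<close>

lemma chaos_spanD:
  assumes "f \<in> chaos_span \<xi> \<Phi> S" "finite S"
  obtains c where "f = (\<lambda>\<omega>. \<Sum>i\<in>S. c i * X i \<omega>)"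
proof -
  obtain A c where "A \<subseteq> S" "f = (\<lambda>\<omega>. \<Sum>i\<in>A. c i * X i \<omega>)"
    using assms(1) by (rule chaos_spanE)
  then have "f = (\<lambda>\<omega>. \<Sum>i\<in>S. (if i \<in> A then c i else 0) * X i \<omega>)"
    using assms(2) by (auto simp: fun_eq_iff intro!: sum.mono_neutral_cong_left)
  then show ?thesis by (rule that)
qed

lemma L2_inner_expansion:
  assumes "finite S"
  shows "L2_inner M (\<lambda>\<omega>. \<Sum>i\<in>S. c i * X i \<omega>) (X j) = (if j \<in> S then c j else 0)"
  using assms by (simp add: L2_inner_sum_left X_L2 X_orthonormal mult_delta_right)

text \<open>Pairing a vanishing combination with \<open>X j\<close> isolates the coefficient of
  \<open>X j\<close>. Here coefficients are indexed by vectors, so the sum is first reindexed along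
  the injection \<open>X\<close>.\<close>

lemma independent_X: "fun_space.independent (X ` S)"
  unfolding fun_space.independent_explicit_module
proof (intro allI impI)
  fix t :: "('a \<Rightarrow> real) set" and u v
  assume t: "finite t" "t \<subseteq> X ` S" and z: "(\<Sum>v\<in>t. (\<lambda>x. u v * v x)) = 0" and v: "v \<in> t"
  obtain A where A: "A \<subseteq> S" "t = X ` A" using t(2) by (auto simp: subset_image_iff)
  have inj: "inj_on X A" using inj_X by (rule inj_on_subset) simp
  have "finite A" using t(1) A(2) inj by (simp add: finite_image_iff)
  obtain j where j: "j \<in> A" "v = X j" using v A by auto
  have "(\<lambda>\<omega>. \<Sum>i\<in>A. u (X i) * X i \<omega>) = (\<lambda>\<omega>. 0)"
    using z unfolding A(2) by (simp add: sum.reindex[OF inj] fun_eq_iff sum_fun_apply)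
  moreover have "L2_inner M (\<lambda>\<omega>. \<Sum>i\<in>A. u (X i) * X i \<omega>) (X j) = u v"
    using j L2_inner_expansion[OF \<open>finite A\<close>, of "\<lambda>i. u (X i)" j] by simp
  ultimately show "u v = 0" by (simp add: L2_inner_def)
qed

section \<open>The chaos basis compared with the monomials\<close>

lemma X_in_span_monomial:
  assumes "mi_abs i \<le> n"
  shows "X i \<in> fun_space.span (monomial ` {m. mi_abs m \<le> n})"
proof -
  have "X i \<in> fun_space.span (monomial ` {m. mi_abs m \<le> mi_abs i})"
    using basis poly_fun_of_degree_in_span by (simp add: gpc_basis_def X_def)
  moreover have "monomial ` {m. mi_abs m \<le> mi_abs i} \<subseteq> monomial ` {m. mi_abs m \<le> n}"
    using assms by auto
  ultimately show ?thesis using fun_space.span_mono by blast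
qed

lemma X_polynomial: "X i \<in> polynomials"
proof -
  have "fun_space.span (monomial ` {m. mi_abs m \<le> mi_abs i}) \<subseteq> polynomials"
    unfolding polynomials_def by (intro fun_space.span_mono image_mono subset_UNIV)
  then show ?thesis using X_in_span_monomial[OF order_refl, of i] by (rule subsetD)
qed

text \<open>This is the count of dimensions, with \<open>mi_abs m\<close> as the common degree
  bound. Injectivity of \<open>X\<close> gives exactly \<open>card ?F\<close> basis elements, while
  there are at most \<open>card ?F\<close> monomials.\<close>

lemma monomial_in_span_X: "monomial m \<in> fun_space.span (range X)"
proof -
  let ?F = "{i :: nat ^ 'd. mi_abs i \<le> mi_abs m}"
  have "monomial ` ?F \<subseteq> fun_space.span (X ` ?F)"
  proof (rule fun_space.subset_span_if_card_le_independent)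
    show "fun_space.independent (X ` ?F)" by (rule independent_X)
    show "X ` ?F \<subseteq> fun_space.span (monomial ` ?F)" using X_in_span_monomial by auto
    show "finite (monomial ` ?F)" by (simp add: finite_mi_abs_le)
    have "card (X ` ?F) = card ?F" using inj_X by (intro card_image inj_on_subset[OF inj_X]) simp
    then show "card (monomial ` ?F) \<le> card (X ` ?F)"
      by (simp add: card_image_le finite_mi_abs_le)
  qed
  moreover have "fun_space.span (X ` ?F) \<subseteq> fun_space.span (range X)"
    by (intro fun_space.span_mono) auto
  ultimately show ?thesis by blast
qed

text \<open>This settles all integrability questions below, because the products, projections and
  unresolved parts that occur are again polynomials in the random vector.\<close>

lemma polynomials_L2: "f \<in> polynomials \<Longrightarrow> f \<in> L2_space M \<xi>"
proof -
  have "fun_space.span (range X) \<subseteq> L2_space M \<xi>"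
    by (rule fun_space.span_minimal[OF image_subsetI[OF X_L2] subspace_L2_space])
  then have "range monomial \<subseteq> L2_space M \<xi>"
    using image_subsetI[OF monomial_in_span_X] by (rule order_trans[rotated])
  then have "polynomials \<subseteq> L2_space M \<xi>"
    unfolding polynomials_def by (rule fun_space.span_minimal[OF _ subspace_L2_space])
  then show "f \<in> polynomials \<Longrightarrow> f \<in> L2_space M \<xi>" by (rule subsetD)
qed

lemma chaos_span_polynomials:
  assumes "f \<in> chaos_span \<xi> \<Phi> S" shows "f \<in> polynomials"
proof -
  obtain A c where "f = (\<lambda>\<omega>. \<Sum>i\<in>A. c i * X i \<omega>)"
    using assms by (rule chaos_spanE)
  then have f: "f = (\<Sum>i\<in>A. (\<lambda>\<omega>. c i * X i \<omega>))"
    by (simp add: fun_eq_iff sum_fun_apply)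
  show ?thesis
    unfolding f by (intro fun_space.subspace_sum fun_space.subspace_scale subspace_polynomials
        X_polynomial)
qed

section \<open>Orthogonal projection onto the span of finitely many basis elements\<close>

lemma X_in_chaos_span: "i \<in> S \<Longrightarrow> X i \<in> chaos_span \<xi> \<Phi> S"
  using chaos_spanI[of "{i}" S "\<lambda>_. 1"] by simp

text \<open>The Fourier sum over \<open>S\<close> has a residual orthogonal to each
  \<open>X i\<close>, hence to the span. Conversely, testing any candidate against
  \<open>X i\<close> forces its coefficients, so the definite description in
  \<open>orth_proj\<close> denotes this sum.\<close>

lemma orth_proj_eq:
  assumes f: "f \<in> L2_space M \<xi>" and S: "finite S"
  shows "orth_proj M (chaos_span \<xi> \<Phi> S) f = (\<lambda>\<omega>. \<Sum>i\<in>S. L2_inner M f (X i) * X i \<omega>)"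
    (is "_ = ?g")
proof -
  let ?V = "chaos_span \<xi> \<Phi> S"
  have V_L2: "h \<in> ?V \<Longrightarrow> h \<in> L2_space M \<xi>" for h
    by (intro polynomials_L2 chaos_span_polynomials)
  have g: "?g \<in> ?V" by (rule chaos_spanI[OF S order_refl])
  have fg: "(\<lambda>\<omega>. f \<omega> - ?g \<omega>) \<in> L2_space M \<xi>" by (rule L2_space_diff[OF f V_L2[OF g]])
  have orth: "L2_inner M (X i) (\<lambda>\<omega>. f \<omega> - ?g \<omega>) = 0" if "i \<in> S" for i
    using that L2_inner_expansion[OF S, of "\<lambda>i. L2_inner M f (X i)" i]
    by (subst L2_inner_commute) (simp add: L2_inner_diff_left f X_L2 V_L2[OF g])
  show ?thesis
    unfolding orth_proj_def
  proof (rule the_equality)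
    have "L2_inner M (\<lambda>\<omega>. f \<omega> - ?g \<omega>) h = 0" if h: "h \<in> ?V" for h
    proof -
      obtain c where c: "h = (\<lambda>\<omega>. \<Sum>i\<in>S. c i * X i \<omega>)" using chaos_spanD[OF h S] .
      have "L2_inner M h (\<lambda>\<omega>. f \<omega> - ?g \<omega>)
          = (\<Sum>i\<in>S. c i * L2_inner M (X i) (\<lambda>\<omega>. f \<omega> - ?g \<omega>))"
        unfolding c by (rule L2_inner_sum_left[OF X_L2 fg])
      also have "\<dots> = 0" using orth by simp
      finally show ?thesis by (simp add: L2_inner_commute)
    qed
    then show "?g \<in> ?V \<and> (\<forall>h\<in>?V. L2_inner M (\<lambda>\<omega>. f \<omega> - ?g \<omega>) h = 0)"
      using g by (intro conjI ballI)
  next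
    fix g assume h: "g \<in> ?V \<and> (\<forall>h\<in>?V. L2_inner M (\<lambda>\<omega>. f \<omega> - g \<omega>) h = 0)"
    obtain c where c: "g = (\<lambda>\<omega>. \<Sum>i\<in>S. c i * X i \<omega>)"
      using chaos_spanD[OF conjunct1[OF h] S] .
    have "c i = L2_inner M f (X i)" if i: "i \<in> S" for i
    proof -
      have "L2_inner M (\<lambda>\<omega>. f \<omega> - g \<omega>) (X i) = 0"
        using conjunct2[OF h] X_in_chaos_span[OF i] by (rule bspec)
      then have "L2_inner M f (X i) = L2_inner M g (X i)"
        using L2_inner_diff_left[OF f V_L2[OF conjunct1[OF h]] X_L2] by simp
      then show ?thesis using L2_inner_expansion[OF S, of c i] i by (simp add: c)
    qed
    then show "g = ?g" unfolding c by simp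
  qed
qed

lemma orth_proj_mem:
  assumes "f \<in> L2_space M \<xi>" "finite S"
  shows "orth_proj M (chaos_span \<xi> \<Phi> S) f \<in> chaos_span \<xi> \<Phi> S"
  unfolding orth_proj_eq[OF assms] by (rule chaos_spanI[OF assms(2) order_refl])

text \<open>Since \<open>f\<close> and its projection have the same coefficients on
  \<open>S\<close>, expanding \<open>h\<close> proves the claim. In this form self-adjointness
  removes the projection from a pairing with a resolved function.\<close>

lemma L2_inner_orth_proj:
  assumes f: "f \<in> L2_space M \<xi>" and S: "finite S" and h: "h \<in> chaos_span \<xi> \<Phi> S"
  shows "L2_inner M h (orth_proj M (chaos_span \<xi> \<Phi> S) f) = L2_inner M h f"
proof -
  let ?Pf = "orth_proj M (chaos_span \<xi> \<Phi> S) f"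
  obtain c where c: "h = (\<lambda>\<omega>. \<Sum>i\<in>S. c i * X i \<omega>)" using chaos_spanD[OF h S] .
  have Pf: "?Pf \<in> L2_space M \<xi>"
    by (rule polynomials_L2[OF chaos_span_polynomials[OF orth_proj_mem[OF f S]]])
  have "L2_inner M (X i) ?Pf = L2_inner M (X i) f" if "i \<in> S" for i
    using that L2_inner_expansion[OF S, of "\<lambda>i. L2_inner M f (X i)" i]
    by (simp add: orth_proj_eq[OF f S] L2_inner_commute[of M "X i"])
  then show ?thesis
    unfolding c by (simp add: L2_inner_sum_left[OF X_L2 Pf] L2_inner_sum_left[OF X_L2 f])
qed

end


section \<open>The energy identity\<close>

text \<open>The energy balance is derived for any finite set of resolved modes; the theorem takes
  \<open>resolved\<close>.\<close>

locale resolved_gpc = gpc M \<xi> \<Phi>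
  for M :: "'a measure" and \<xi> :: "'a \<Rightarrow> real ^ 'd" and \<Phi> :: "nat ^ 'd \<Rightarrow> real ^ 'd \<Rightarrow> real" +
  fixes S :: "(nat ^ 'd) set"
  assumes finite_S: "finite S"
begin

section \<open>Resolved and unresolved parts of polynomials\<close>

abbreviation V :: "('a \<Rightarrow> real) set" where
  "V \<equiv> chaos_span \<xi> \<Phi> S"

abbreviation P :: "('a \<Rightarrow> real) \<Rightarrow> 'a \<Rightarrow> real" where
  "P \<equiv> orth_proj M V"

lemma P_mem: "f \<in> polynomials \<Longrightarrow> P f \<in> V"
  by (intro orth_proj_mem polynomials_L2 finite_S)

lemma P_polynomial: "f \<in> polynomials \<Longrightarrow> P f \<in> polynomials"
  by (rule chaos_span_polynomials[OF P_mem])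

lemma L2_inner_P: "f \<in> polynomials \<Longrightarrow> u \<in> V \<Longrightarrow> L2_inner M u (P f) = L2_inner M u f"
  by (intro L2_inner_orth_proj polynomials_L2 finite_S)

lemma compl_proj_polynomial: "f \<in> polynomials \<Longrightarrow> compl_proj P f \<in> polynomials"
  unfolding compl_proj_def by (intro polynomials_diff P_polynomial)

text \<open>The unresolved part of \<open>f\<close> is orthogonal to \<open>V\<close>, in particular
  to \<open>P g\<close>, so it only sees the unresolved part of \<open>g\<close>.\<close>

lemma L2_inner_compl_proj:
  assumes f: "f \<in> polynomials" and g: "g \<in> polynomials"
  shows "L2_inner M (compl_proj P f) g = L2_inner M (compl_proj P f) (compl_proj P g)"
proof -
  have Q: "compl_proj P f \<in> polynomials" by (rule compl_proj_polynomial[OF f])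
  have "L2_inner M (compl_proj P f) (P g) = L2_inner M (P g) f - L2_inner M (P g) (P f)"
    unfolding compl_proj_def
    by (simp add: L2_inner_diff_left L2_inner_commute[of M _ "P g"] L2_inner_diff_right
        polynomials_L2 P_polynomial f g)
  also have "\<dots> = 0" using L2_inner_P[OF f P_mem[OF g]] by simp
  finally show ?thesis
    unfolding compl_proj_def[of P g]
    by (simp add: L2_inner_diff_right polynomials_L2 P_polynomial Q g)
qed

text \<open>This is the algebraic content at a single instant: \<open>u1\<close>, \<open>u2\<close>,
  \<open>u3\<close> are any resolved functions, and no derivative is involved.\<close>

lemma t_model_energy:
  assumes u1: "u1 \<in> V" and u2: "u2 \<in> V" and u3: "u3 \<in> V"
  shows "L2_inner M u1 (t_model_rhs1 P t u1 u2 u3) + L2_inner M u2 (t_model_rhs2 P t u1 u2 u3) +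
      L2_inner M u3 (t_model_rhs3 P t u1 u2 u3)
    = - t * (L2_norm3 M (Gamma1 P u1 u3) (Gamma2 P u2 u3) (Gamma3 P u1 u2))\<^sup>2"
proof -
  note pu = u1[THEN chaos_span_polynomials] u2[THEN chaos_span_polynomials]
    u3[THEN chaos_span_polynomials]
  define G1 G2 G3 where "G1 = Gamma1 P u1 u3" and "G2 = Gamma2 P u2 u3" and "G3 = Gamma3 P u1 u2"
  have G: "G1 \<in> polynomials" "G2 \<in> polynomials" "G3 \<in> polynomials"
    unfolding G1_def G2_def G3_def Gamma1_def Gamma2_def Gamma3_def
    by (intro compl_proj_polynomial polynomials_add polynomials_uminus polynomials_B pu)+
  \<comment> \<open>The two summands agree by commutativity. The resulting factor 2 outweighs the
    opposite contributions of the first two equations and decides the final sign.\<close>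
  have s1: "(\<lambda>\<omega>. B G1 u1 \<omega> + B u1 G1 \<omega>) = (\<lambda>\<omega>. 2 * B G1 u1 \<omega>)"
    and s2: "(\<lambda>\<omega>. B G2 u2 \<omega> + B u2 G2 \<omega>) = (\<lambda>\<omega>. 2 * B G2 u2 \<omega>)"
    by (auto simp: B_def)
  note L2 = polynomials_L2 polynomials_B polynomials_add polynomials_diff polynomials_mult
    polynomials_uminus P_polynomial compl_proj_polynomial pu G
  note inner = L2_inner_add_right L2_inner_diff_right L2_inner_minus_right L2_inner_mult_right
    L2_inner_P
  \<comment> \<open>The projections drop out against \<open>u1\<close>; what remains on both sides
    are integrals of the same triple products. The other two equations are treated alike.\<close>
  have e1: "L2_inner M u1 (t_model_rhs1 P t u1 u2 u3)
      = L2_inner M (B u1 u1) u3 + t * L2_inner M G1 (B u1 u3) + t * L2_inner M (B u1 u1) G3"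
    unfolding t_model_rhs1_def G1_def[symmetric] G3_def[symmetric]
    by (simp add: inner L2 u1)
      (simp add: L2_inner_def B_def mult_ac)
  have e2: "L2_inner M u2 (t_model_rhs2 P t u1 u2 u3)
      = - L2_inner M (B u2 u2) u3 - t * L2_inner M G2 (B u2 u3) - t * L2_inner M (B u2 u2) G3"
    unfolding t_model_rhs2_def G2_def[symmetric] G3_def[symmetric]
    by (simp add: inner L2 u2)
      (simp add: L2_inner_def B_def mult_ac)
  have e3: "L2_inner M u3 (t_model_rhs3 P t u1 u2 u3)
      = - L2_inner M (B u1 u1) u3 + L2_inner M (B u2 u2) u3
        - 2 * t * L2_inner M G1 (B u1 u3) + 2 * t * L2_inner M G2 (B u2 u3)"
    unfolding t_model_rhs3_def G1_def[symmetric] G2_def[symmetric] s1 s2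
    by (simp add: inner L2 u3)
      (simp add: L2_inner_def B_def mult_ac)
  \<comment> \<open>\<open>L2_inner_compl_proj\<close> is read from right to left: one unresolved
    part in the squared norm is replaced by the full product.\<close>
  have g1: "L2_inner M G1 (B u1 u3) = L2_inner M G1 G1"
    unfolding G1_def Gamma1_def by (simp add: L2_inner_compl_proj[symmetric] L2)
  have g2: "L2_inner M G2 (B u2 u3) = - L2_inner M G2 G2"
    unfolding G2_def Gamma2_def
    by (simp add: L2_inner_minus_left L2_inner_minus_right L2_inner_compl_proj[symmetric] L2)
  have g3: "L2_inner M (B u1 u1) G3 - L2_inner M (B u2 u2) G3 = - L2_inner M G3 G3"
  proof -
    let ?Q1 = "compl_proj P (B u1 u1)" and ?Q2 = "compl_proj P (B u2 u2)"
    \<comment> \<open>\<open>G3\<close> is a difference of unresolved parts, so its pairing with any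
      \<open>h\<close> equals that with \<open>compl_proj P h\<close>. Applied to both squares, this
      leaves \<open>?Q1 - ?Q2 = - G3\<close> paired with \<open>G3\<close>.\<close>
    have G3: "G3 = (\<lambda>\<omega>. ?Q2 \<omega> - ?Q1 \<omega>)" by (simp add: G3_def Gamma3_def)
    have "L2_inner M h G3 = L2_inner M ?Q2 h - L2_inner M ?Q1 h" if "h \<in> polynomials" for h
      unfolding G3
      by (subst L2_inner_commute) (simp add: L2_inner_diff_left L2 that)
    then have "L2_inner M h G3 = L2_inner M (compl_proj P h) G3" if "h \<in> polynomials" for h
      using that by (simp add: L2 L2_inner_compl_proj[of _ h])
    moreover have "L2_inner M G3 G3 = L2_inner M ?Q2 G3 - L2_inner M ?Q1 G3"
      by (subst (1) G3) (simp add: L2_inner_diff_left L2)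
    ultimately show ?thesis by (simp add: L2)
  qed
  \<comment> \<open>The cubic terms cancel, and the coefficients combine as \<open>t - 2 * t\<close>
    for \<open>G1\<close> and \<open>- t + 2 * t\<close> for \<open>G2\<close>.\<close>
  have "L2_inner M u1 (t_model_rhs1 P t u1 u2 u3) + L2_inner M u2 (t_model_rhs2 P t u1 u2 u3) +
      L2_inner M u3 (t_model_rhs3 P t u1 u2 u3)
    = - t * L2_inner M G1 (B u1 u3) + t * L2_inner M G2 (B u2 u3)
      + t * (L2_inner M (B u1 u1) G3 - L2_inner M (B u2 u2) G3)"
    unfolding e1 e2 e3 by (simp add: algebra_simps)
  also have "\<dots> = - t * (L2_norm3 M G1 G2 G3)\<^sup>2"
    unfolding g1 g2 g3 L2_norm3_power2 by (simp add: algebra_simps)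
  finally show ?thesis unfolding G1_def G2_def G3_def .
qed

end

section \<open>The energy balance along a solution\<close>

theorem theorem1:
  fixes M :: "'a measure"
    and \<xi> :: "'a \<Rightarrow> real ^ 'd"
    and \<Phi> :: "nat ^ 'd \<Rightarrow> real ^ 'd \<Rightarrow> real"
    and p\<^sub>r :: nat
    and T :: "real set"
    and y1 y2 y3 :: "real \<Rightarrow> 'a \<Rightarrow> real"
    and P :: "('a \<Rightarrow> real) \<Rightarrow> ('a \<Rightarrow> real)"
  assumes "prob_space M"
    and "\<xi> \<in> borel_measurable M"
    and "gpc_basis M \<xi> \<Phi>"
    and "is_interval T" and "T \<subseteq> {0..}"
    and "t_model_solution M \<xi> \<Phi> p\<^sub>r T y1 y2 y3"
    and "P = orth_proj M (chaos_span \<xi> \<Phi> (resolved p\<^sub>r))"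
  shows "\<forall>t\<in>T.
    ((\<lambda>s. 1 / 2 * (L2_norm3 M (y1 s) (y2 s) (y3 s))\<^sup>2) has_real_derivative
      - t * (L2_norm3 M (Gamma1 P (y1 t) (y3 t)) (Gamma2 P (y2 t) (y3 t)) (Gamma3 P (y1 t) (y2 t)))\<^sup>2)
    (at t within T)"
proof
  fix t assume t: "t \<in> T"
  interpret R: resolved_gpc M \<xi> \<Phi> "resolved p\<^sub>r"
    using assms(2,3) by unfold_locales (auto simp: resolved_def finite_mi_abs_le)
  let ?f1 = "t_model_rhs1 P t (y1 t) (y2 t) (y3 t)"
    and ?f2 = "t_model_rhs2 P t (y1 t) (y2 t) (y3 t)"
    and ?f3 = "t_model_rhs3 P t (y1 t) (y2 t) (y3 t)"
  have V: "y1 t \<in> R.V" "y2 t \<in> R.V" "y3 t \<in> R.V"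
    and d: "has_L2_derivative_within M \<xi> T y1 ?f1 t"
      "has_L2_derivative_within M \<xi> T y2 ?f2 t"
      "has_L2_derivative_within M \<xi> T y3 ?f3 t"
    using assms(6) t unfolding t_model_solution_def Let_def assms(7) by auto
  \<comment> \<open>Each squared norm is differentiated separately within \<open>T\<close>; the
    factor 1/2 cancels the 2 of each derivative, leaving the sum evaluated by
    \<open>t_model_energy\<close>.\<close>
  have "((\<lambda>s. 1 / 2 * (L2_norm3 M (y1 s) (y2 s) (y3 s))\<^sup>2) has_real_derivative
      1 / 2 * (2 * L2_inner M (y1 t) ?f1 + 2 * L2_inner M (y2 t) ?f2 + 2 * L2_inner M (y3 t) ?f3))
      (at t within T)"
    unfolding L2_norm3_power2
    by (intro DERIV_cmult DERIV_add d[THEN R.has_L2_derivative_within_norm_square] t)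
  then show "((\<lambda>s. 1 / 2 * (L2_norm3 M (y1 s) (y2 s) (y3 s))\<^sup>2) has_real_derivative
      - t * (L2_norm3 M (Gamma1 P (y1 t) (y3 t)) (Gamma2 P (y2 t) (y3 t)) (Gamma3 P (y1 t) (y2 t)))\<^sup>2)
      (at t within T)"
    using R.t_model_energy[OF V, of t] unfolding assms(7) by (simp add: algebra_simps)
qed

end
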